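(* Let $f:[0,1]\to[0,1]$ be given by $f(\Delta^{3}_{\alpha_1\alpha_2\ldots\alpha_n\ldots})=\Delta^{3}_{\varphi(\alpha_1)\varphi(\alpha_2)\ldots\varphi(\alpha_n)\ldots}$, where $\varphi(0)=0$, $\varphi(1)=2$, $\varphi(2)=1$. Then the Hausdorff–Besicovitch dimension of the graph $\Gamma_f=\{(x,f(x)): x\in[0,1]\}\subset\mathbb{R}^2$ is equal to $1$.
   Context: For digits $\alpha_n\in\{0,1,2\}$, $\Delta^{3}_{\alpha_1\alpha_2\ldots\alpha_n\ldots}$ denotes $\sum_{n=1}^{\infty}\alpha_n 3^{-n}$. Every $x\in[0,1]$ is written using its ternary representation that does not end in an infinite string of 2's, except that $1$ is written as $\Delta^{3}_{222\ldots}$; thus each $x$ has exactly one admissible digit sequence, and it is this sequence that is used in the definition of $f$. The Hausdorff–Besicovitch dimension is the usual Hausdorff dimension. *)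

theory Defs
  imports "HOL-Analysis.Analysis"
begin

text \<open>The \<open>s\<close>-th power of the diameter, with the conventions that the empty set contributes \<open>0\<close>
  and that \<open>0\<^sup>0 = 1\<close> for a nonempty set (in the library, \<open>0 powr 0 = 0\<close>).\<close>

definition diam_pow :: "real \<Rightarrow> 'a::metric_space set \<Rightarrow> ennreal" where
  "diam_pow s U = (if U = {} then 0 else if s = 0 then 1 else ennreal (diameter U powr s))"

text \<open>Boundedness is required explicitly because \<^const>\<open>diameter\<close> is meaningless on unbounded sets.
  Finite covers are included, since \<open>U n\<close> may be empty.\<close>

definition delta_covers :: "real \<Rightarrow> 'a::metric_space set \<Rightarrow> (nat \<Rightarrow> 'a set) set" where
  "delta_covers \<delta> A = {U. A \<subseteq> (\<Union>n. U n) \<and> (\<forall>n. bounded (U n) \<and> diameter (U n) \<le> \<delta>)}"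

definition hausdorff_premeasure :: "real \<Rightarrow> real \<Rightarrow> 'a::metric_space set \<Rightarrow> ennreal" where
  "hausdorff_premeasure s \<delta> A = (INF U\<in>delta_covers \<delta> A. \<Sum>n. diam_pow s (U n))"

definition hausdorff_measure :: "real \<Rightarrow> 'a::metric_space set \<Rightarrow> ennreal" where
  "hausdorff_measure s A = (SUP \<delta>\<in>{0<..}. hausdorff_premeasure s \<delta> A)"

definition hausdorff_dim :: "'a::metric_space set \<Rightarrow> ennreal" where
  "hausdorff_dim A = (INF s\<in>{s. 0 \<le> s \<and> hausdorff_measure s A = 0}. ennreal s)"

text \<open>Digit sequences are indexed from \<open>0\<close>: \<open>\<alpha> n\<close> is the digit with weight \<open>1 / 3 ^ Suc n\<close>.\<close>

definition ternary_value :: "(nat \<Rightarrow> nat) \<Rightarrow> real" where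
  "ternary_value \<alpha> = (\<Sum>n. real (\<alpha> n) / 3 ^ Suc n)"

definition admissible :: "(nat \<Rightarrow> nat) \<Rightarrow> bool" where
  "admissible \<alpha> \<longleftrightarrow> (\<forall>n. \<alpha> n \<in> {0, 1, 2}) \<and>
     ((\<forall>n. \<alpha> n = 2) \<or> \<not> (\<exists>N. \<forall>n\<ge>N. \<alpha> n = 2))"

text \<open>For \<open>x\<close> in \<open>{0..1}\<close> this is well defined, see \<open>ternary_digits_eq\<close> and
  \<open>ternary_expansion_ex1\<close> below.\<close>

definition ternary_digits :: "real \<Rightarrow> nat \<Rightarrow> nat" where
  "ternary_digits x = (THE \<alpha>. admissible \<alpha> \<and> ternary_value \<alpha> = x)"

definition swap12 :: "nat \<Rightarrow> nat" where
  "swap12 d = (if d = 1 then 2 else if d = 2 then 1 else 0)"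

definition swap_fun :: "real \<Rightarrow> real" where
  "swap_fun x = ternary_value (swap12 \<circ> ternary_digits x)"

lemma twos_sums: "(\<lambda>n. 2 / 3 ^ Suc n :: real) sums 1"
proof -
  have "(\<lambda>n. (2/3) * (1/3) ^ n :: real) sums ((2/3) * (1 / (1 - 1/3)))"
    by (intro sums_mult geometric_sums) auto
  then show ?thesis
    by (simp add: power_one_over field_simps)
qed

lemma ternary_summable:
  assumes "\<And>n. \<alpha> n \<le> 2"
  shows "summable (\<lambda>n. real (\<alpha> n) / 3 ^ Suc n)"
proof (rule summable_comparison_test')
  show "summable (\<lambda>n. 2 / 3 ^ Suc n :: real)"
    using twos_sums by (rule sums_summable)
  show "norm (real (\<alpha> n) / 3 ^ Suc n) \<le> 2 / 3 ^ Suc n" for n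
    using assms[of n] by (auto intro!: divide_right_mono)
qed

lemma ternary_value_nonneg: "(\<And>n. \<alpha> n \<le> 2) \<Longrightarrow> 0 \<le> ternary_value \<alpha>"
  unfolding ternary_value_def by (rule suminf_nonneg[OF ternary_summable]) auto

lemma ternary_value_le_1:
  assumes "\<And>n. \<alpha> n \<le> 2"
  shows "ternary_value \<alpha> \<le> 1"
proof -
  have "real (\<alpha> n) / 3 ^ Suc n \<le> 2 / 3 ^ Suc n" for n
    using assms[of n] by (intro divide_right_mono) auto
  then have "ternary_value \<alpha> \<le> (\<Sum>n. 2 / 3 ^ Suc n)"
    unfolding ternary_value_def
    by (rule suminf_le[OF _ ternary_summable[OF assms] sums_summable[OF twos_sums]])
  also have "\<dots> = 1"
    using twos_sums by (rule sums_unique[symmetric])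
  finally show ?thesis .
qed

lemma ternary_value_rec:
  assumes "\<And>n. \<alpha> n \<le> 2"
  shows "ternary_value \<alpha> = (real (\<alpha> 0) + ternary_value (\<lambda>n. \<alpha> (Suc n))) / 3"
proof -
  have "ternary_value \<alpha> = real (\<alpha> 0) / 3 + (\<Sum>n. real (\<alpha> (Suc n)) / 3 ^ Suc (Suc n))"
    unfolding ternary_value_def using suminf_split_head[OF ternary_summable, of \<alpha>] assms by simp
  also have "(\<Sum>n. real (\<alpha> (Suc n)) / 3 ^ Suc (Suc n)) = (\<Sum>n. (real (\<alpha> (Suc n)) / 3 ^ Suc n) / 3)"
    by (simp add: field_simps)
  also have "\<dots> = ternary_value (\<lambda>n. \<alpha> (Suc n)) / 3"
    unfolding ternary_value_def
    by (rule suminf_divide) (rule ternary_summable, rule assms)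
  finally show ?thesis by (simp add: field_simps)
qed

lemma ternary_value_eq_1:
  assumes "\<And>n. \<alpha> n \<le> 2" "ternary_value \<alpha> = 1"
  shows "\<alpha> n = 2"
  using assms
proof (induction n arbitrary: \<alpha>)
  case 0
  have "ternary_value (\<lambda>n. \<alpha> (Suc n)) \<le> 1"
    using 0 by (intro ternary_value_le_1) auto
  with ternary_value_rec[of \<alpha>] 0 have "real (\<alpha> 0) \<ge> 2" by simp
  with 0(1)[of 0] show ?case by simp
next
  case (Suc n)
  have "ternary_value (\<lambda>n. \<alpha> (Suc n)) \<le> 1"
    using Suc.prems by (intro ternary_value_le_1) auto
  moreover have "real (\<alpha> 0) \<le> 2" using Suc.prems(1)[of 0] by simp
  ultimately have "ternary_value (\<lambda>n. \<alpha> (Suc n)) = 1"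
    using ternary_value_rec[of \<alpha>, OF Suc.prems(1)] Suc.prems(2) by argo
  from Suc.IH[OF _ this] Suc.prems show ?case by simp
qed

lemma admissible_le_2: "admissible \<alpha> \<Longrightarrow> \<alpha> n \<le> 2"
  unfolding admissible_def by (metis insertE empty_iff order_refl zero_le one_le_numeral)

lemma admissible_inj:
  assumes a: "admissible \<alpha>" and b: "admissible \<beta>" and eq: "ternary_value \<alpha> = ternary_value \<beta>"
  shows "\<alpha> = \<beta>"
proof (cases "ternary_value \<alpha> = 1")
  case True
  then show ?thesis
    using eq ternary_value_eq_1[of \<alpha>] ternary_value_eq_1[of \<beta>]
      admissible_le_2[OF a] admissible_le_2[OF b] by auto
next
  case False
  have tail: "ternary_value (\<lambda>k. \<gamma> (k + n)) < 1"
    if g: "admissible \<gamma>" and ne: "ternary_value \<gamma> \<noteq> 1" for \<gamma> n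
  proof -
    have le: "\<gamma> k \<le> 2" for k using admissible_le_2[OF g] .
    have no: "\<not> (\<forall>k\<ge>n. \<gamma> k = 2)"
    proof
      assume "\<forall>k\<ge>n. \<gamma> k = 2"
      with g have "\<gamma> = (\<lambda>_. 2)" unfolding admissible_def by auto
      then have "ternary_value \<gamma> = 1"
        unfolding ternary_value_def using sums_unique[OF twos_sums] by simp
      with ne show False by simp
    qed
    have "ternary_value (\<lambda>k. \<gamma> (k + n)) \<noteq> 1"
    proof
      assume *: "ternary_value (\<lambda>k. \<gamma> (k + n)) = 1"
      have "\<gamma> (k + n) = 2" for k
        using ternary_value_eq_1[OF _ *] le by simp
      then have "\<forall>k\<ge>n. \<gamma> k = 2" by (metis le_add_diff_inverse2)
      with no show False by simp
    qed
    with ternary_value_le_1[of "\<lambda>k. \<gamma> (k + n)"] le show ?thesis by force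
  qed
  have head: "int (\<gamma> n) = \<lfloor>3 * ternary_value (\<lambda>k. \<gamma> (k + n))\<rfloor>"
    "ternary_value (\<lambda>k. \<gamma> (k + Suc n)) = 3 * ternary_value (\<lambda>k. \<gamma> (k + n)) - real (\<gamma> n)"
    if g: "admissible \<gamma>" and ne: "ternary_value \<gamma> \<noteq> 1" for \<gamma> n
  proof -
    have rec: "ternary_value (\<lambda>k. \<gamma> (k + n)) = (real (\<gamma> n) + ternary_value (\<lambda>k. \<gamma> (k + Suc n))) / 3"
      using ternary_value_rec[of "\<lambda>k. \<gamma> (k + n)"] admissible_le_2[OF g] by simp
    then show "ternary_value (\<lambda>k. \<gamma> (k + Suc n)) = 3 * ternary_value (\<lambda>k. \<gamma> (k + n)) - real (\<gamma> n)"
      by simp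
    moreover have "0 \<le> ternary_value (\<lambda>k. \<gamma> (k + Suc n))"
      using admissible_le_2[OF g] by (intro ternary_value_nonneg)
    moreover note tail[OF g ne, of "Suc n"]
    ultimately show "int (\<gamma> n) = \<lfloor>3 * ternary_value (\<lambda>k. \<gamma> (k + n))\<rfloor>"
      by linarith
  qed
  have ne': "ternary_value \<beta> \<noteq> 1" using eq False by simp
  have tails: "ternary_value (\<lambda>k. \<alpha> (k + n)) = ternary_value (\<lambda>k. \<beta> (k + n))" for n
  proof (induction n)
    case 0
    then show ?case using eq by simp
  next
    case (Suc n)
    have "int (\<alpha> n) = int (\<beta> n)"
      unfolding head(1)[OF a False] head(1)[OF b ne'] Suc ..
    then show ?case
      unfolding head(2)[OF a False] head(2)[OF b ne'] Suc by simp
  qed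
  show ?thesis
  proof
    fix n
    have "int (\<alpha> n) = int (\<beta> n)"
      unfolding head(1)[OF a False] head(1)[OF b ne'] tails ..
    then show "\<alpha> n = \<beta> n" by simp
  qed
qed

lemma admissible_ex:
  assumes x: "x \<in> {0..1}"
  shows "\<exists>\<alpha>. admissible \<alpha> \<and> ternary_value \<alpha> = x"
proof (cases "x = 1")
  case True
  have "admissible (\<lambda>_. 2)" by (simp add: admissible_def)
  moreover have "ternary_value (\<lambda>_. 2) = 1"
    unfolding ternary_value_def using sums_unique[OF twos_sums] by simp
  ultimately show ?thesis using True by blast
next
  case False
  define t where "t n = ((\<lambda>y. frac (3 * y)) ^^ n) x" for n
  define \<alpha> where "\<alpha> n = nat \<lfloor>3 * t n\<rfloor>" for n
  have t0: "t 0 = x" and tS: "t (Suc n) = frac (3 * t n)" for n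
    by (simp_all add: t_def)
  have t: "0 \<le> t n \<and> t n < 1" for n
    using x False by (cases n) (auto simp: t0 tS frac_lt_1)
  have \<alpha>_real: "real (\<alpha> n) = 3 * t n - t (Suc n)" for n
    using t[of n] by (simp add: \<alpha>_def tS frac_def)
  have \<alpha>_le: "\<alpha> n \<le> 2" for n
    using t[of n] unfolding \<alpha>_def by linarith
  have tails: "ternary_value (\<lambda>k. \<alpha> (k + n)) = t n" for n
  proof -
    have part: "(\<Sum>k<m. real (\<alpha> (k + n)) / 3 ^ Suc k) = t n - t (m + n) / 3 ^ m" for m
      by (induction m) (simp_all add: \<alpha>_real field_simps)
    have "(\<lambda>m. t (m + n) / 3 ^ m) \<longlonglongrightarrow> 0"
    proof (rule Lim_null_comparison)
      show "\<forall>\<^sub>F m in sequentially. norm (t (m + n) / 3 ^ m) \<le> (1/3) ^ m"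
        using t by (intro always_eventually) (auto simp: power_one_over divide_right_mono less_imp_le)
      show "(\<lambda>m. (1/3) ^ m :: real) \<longlonglongrightarrow> 0"
        by (rule LIMSEQ_power_zero) simp
    qed
    then have "(\<lambda>m. t n - t (m + n) / 3 ^ m) \<longlonglongrightarrow> t n - 0"
      by (intro tendsto_intros)
    then have "(\<lambda>k. real (\<alpha> (k + n)) / 3 ^ Suc k) sums t n"
      unfolding sums_def part by simp
    then show ?thesis
      unfolding ternary_value_def by (rule sums_unique[symmetric])
  qed
  have "\<not> (\<exists>N. \<forall>n\<ge>N. \<alpha> n = 2)"
  proof
    assume "\<exists>N. \<forall>n\<ge>N. \<alpha> n = 2"
    then obtain N where N: "\<And>n. n \<ge> N \<Longrightarrow> \<alpha> n = 2" by blast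
    have "t N = 1"
      using sums_unique[OF twos_sums] N
      unfolding tails[symmetric] ternary_value_def by simp
    with t[of N] show False by simp
  qed
  moreover have "\<alpha> n \<in> {0, 1, 2}" for n
    using \<alpha>_le[of n] by auto
  ultimately have "admissible \<alpha>" unfolding admissible_def by blast
  with tails[of 0] t0 show ?thesis by auto
qed

lemma ternary_expansion_ex1:
  "x \<in> {0..1} \<Longrightarrow> \<exists>!\<alpha>. admissible \<alpha> \<and> ternary_value \<alpha> = x"
  using admissible_ex admissible_inj by metis

lemma ternary_digits_eq: "admissible \<alpha> \<Longrightarrow> ternary_digits (ternary_value \<alpha>) = \<alpha>"
  unfolding ternary_digits_def by (rule the_equality) (auto intro: admissible_inj)

lemma swap_fun_ternary_value:
  "admissible \<alpha> \<Longrightarrow> swap_fun (ternary_value \<alpha>) = ternary_value (swap12 \<circ> \<alpha>)"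
  by (simp add: swap_fun_def ternary_digits_eq)

lemma swap_fun_range: "swap_fun \<in> {0..1} \<rightarrow> {0..1}"
  by (auto simp: swap_fun_def swap12_def intro!: ternary_value_nonneg ternary_value_le_1)

end

theory Submission
  imports Defs
begin

text \<open>The graph is contained in the self-similar set generated by the three contractions
  \<open>(x, y) \<mapsto> ((d + x) / 3, (\<phi> d + y) / 3)\<close>, hence is covered by \<open>3 ^ n\<close> balls of radius
  comparable to \<open>3 ^ -n\<close>, so its dimension is at most \<open>1\<close>. Conversely, the projection
  to the first coordinate does not increase diameters and is onto \<open>[0, 1]\<close>, so the
  diameters of a cover sum up to at least the Lebesgue measure \<open>1\<close>.\<close>

lemma hausdorff_premeasure_le_finite_cballs:
  fixes A :: "'a::euclidean_space set"
  assumes cover: "A \<subseteq> (\<Union>k<N. cball (c k) r)" and r: "0 < r" "2 * r \<le> \<delta>" and s: "0 < s"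
  shows "hausdorff_premeasure s \<delta> A \<le> ennreal (real N * (2 * r) powr s)"
proof -
  \<comment> \<open>Padding by empty sets, which \<open>diam_pow\<close> counts as 0, makes a
    sequence of the finite family.\<close>
  define U where "U k = (if k < N then cball (c k) r else {})" for k
  have "U \<in> delta_covers \<delta> A"
    using cover r by (force simp: delta_covers_def U_def)
  then have "hausdorff_premeasure s \<delta> A \<le> (\<Sum>k. diam_pow s (U k))"
    unfolding hausdorff_premeasure_def by (rule INF_lower)
  also have "\<dots> = (\<Sum>k<N. diam_pow s (U k))"
    by (rule suminf_finite) (auto simp: U_def diam_pow_def)
  also have "\<dots> = (\<Sum>k<N. ennreal ((2 * r) powr s))"
    using r s by (intro sum.cong) (auto simp: U_def diam_pow_def)
  also have "\<dots> = ennreal (real N * (2 * r) powr s)"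
    by (simp add: ennreal_mult ennreal_of_nat_eq_real_of_nat)
  finally show ?thesis .
qed

text \<open>The level-n cover costs a constant times (b^(1-s))^n. Since s > 1 this is a null
  sequence, and it bounds the premeasure, which does not depend on n.\<close>

lemma hausdorff_measure_eq_0_if_power_cballs:
  fixes A :: "'a::euclidean_space set"
  assumes cover: "\<And>n. \<exists>c. A \<subseteq> (\<Union>k<b ^ n. cball (c k) (K / real b ^ n))"
    and b: "2 \<le> b" and K: "0 < K" and s: "1 < s"
  shows "hausdorff_measure s A = 0"
proof -
  have "hausdorff_premeasure s \<delta> A \<le> 0" if "0 < \<delta>" for \<delta>
  proof (rule tendsto_lowerbound)
    have eq: "real (b ^ n) * (2 * (K / real b ^ n)) powr s
        = (2 * K) powr s * (real b powr (1 - s)) ^ n" for n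
      using b K
      by (simp add: powr_divide powr_powr powr_power powr_diff powr_realpow[symmetric]
          powr_mult right_diff_distrib mult.commute)
    have "real b powr (1 - s) < 1"
      using b s by (simp add: powr_less_one)
    then have "(\<lambda>n. (2 * K) powr s * (real b powr (1 - s)) ^ n) \<longlonglongrightarrow> (2 * K) powr s * 0"
      by (intro tendsto_intros LIMSEQ_power_zero) simp
    then show "(\<lambda>n. ennreal (real (b ^ n) * (2 * (K / real b ^ n)) powr s)) \<longlonglongrightarrow> 0"
      unfolding eq using tendsto_ennrealI by fastforce
    \<comment> \<open>Only levels whose balls have diameter at most \<open>\<delta>\<close> are
      allowed as covers; this holds for all large n.\<close>
    have "(\<lambda>n. 2 * K * (1 / real b) ^ n) \<longlonglongrightarrow> 2 * K * 0"
      using b by (intro tendsto_intros LIMSEQ_power_zero) simp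
    then have "\<forall>\<^sub>F n in sequentially. 2 * K * (1 / real b) ^ n < \<delta>"
      using that by (intro order_tendstoD) auto
    then show "\<forall>\<^sub>F n in sequentially. hausdorff_premeasure s \<delta> A
        \<le> ennreal (real (b ^ n) * (2 * (K / real b ^ n)) powr s)"
    proof eventually_elim
      case (elim n)
      obtain c where "A \<subseteq> (\<Union>k<b ^ n. cball (c k) (K / real b ^ n))"
        using cover by blast
      then show ?case
        using b K s elim
        by (intro hausdorff_premeasure_le_finite_cballs) (auto simp: power_one_over)
    qed
  qed simp
  then show ?thesis
    unfolding hausdorff_measure_def by (intro antisym SUP_least) auto
qed

text \<open>The first digit selects one of three contractions of ratio 1/3, and the tail gives a
  point already covered at level n. Ranging over all sequences of digits at most 2, admissible or
  not, makes the hypothesis pass to the tail at once.\<close>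

lemma swap_pair_cover:
  "\<exists>c::nat \<Rightarrow> real \<times> real. \<forall>\<alpha>. (\<forall>i. \<alpha> i \<le> 2) \<longrightarrow>
    (\<exists>k<3 ^ n. (ternary_value \<alpha>, ternary_value (swap12 \<circ> \<alpha>)) \<in> cball (c k) (2 / 3 ^ n))"
proof (induction n)
  case 0
  \<comment> \<open>Both coordinates lie in [0, 1], so the crude radius 2 suffices.\<close>
  have "(ternary_value \<alpha>, ternary_value (swap12 \<circ> \<alpha>)) \<in> cball (0, 0) 2"
    if "\<forall>i. \<alpha> i \<le> 2" for \<alpha>
  proof -
    have le: "\<alpha> i \<le> 2" and sw: "(swap12 \<circ> \<alpha>) i \<le> 2" for i
      using that by (simp_all add: swap12_def)
    have "norm (ternary_value \<alpha>, ternary_value (swap12 \<circ> \<alpha>))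
        \<le> norm (ternary_value \<alpha>) + norm (ternary_value (swap12 \<circ> \<alpha>))"
      by (rule norm_Pair_le)
    also have "\<dots> \<le> 2"
      using ternary_value_nonneg[of \<alpha>, OF le] ternary_value_le_1[of \<alpha>, OF le]
        ternary_value_nonneg[of "swap12 \<circ> \<alpha>", OF sw] ternary_value_le_1[of "swap12 \<circ> \<alpha>", OF sw]
      unfolding real_norm_def by linarith
    finally show ?thesis
      by (simp flip: zero_prod_def)
  qed
  then show ?case
    by (intro exI[of _ "\<lambda>_. (0, 0)"] allI impI exI[of _ 0]) (simp del: o_apply mem_cball)
next
  case (Suc n)
  then obtain c :: "nat \<Rightarrow> real \<times> real" where c: "\<And>\<alpha>. \<forall>i. \<alpha> i \<le> 2 \<Longrightarrow>
    \<exists>k<3 ^ n. (ternary_value \<alpha>, ternary_value (swap12 \<circ> \<alpha>)) \<in> cball (c k) (2 / 3 ^ n)"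
    by blast
  \<comment> \<open>The index encodes a digit and an older index in base 3: \<open>k mod 3\<close>
    picks the contraction, \<open>k div 3\<close> the centre it is applied to.\<close>
  define c' where "c' k = (1/3) *\<^sub>R ((real (k mod 3), real (swap12 (k mod 3))) + c (k div 3))" for k
  have "\<exists>k<3 ^ Suc n. (ternary_value \<alpha>, ternary_value (swap12 \<circ> \<alpha>)) \<in> cball (c' k) (2 / 3 ^ Suc n)"
    if \<alpha>: "\<forall>i. \<alpha> i \<le> 2" for \<alpha>
  proof -
    define \<beta> where "\<beta> i = \<alpha> (Suc i)" for i
    define p where "p = (ternary_value \<beta>, ternary_value (swap12 \<circ> \<beta>))"
    have "\<forall>i. \<beta> i \<le> 2"
      using \<alpha> by (simp add: \<beta>_def)
    from c[OF this] obtain k where k: "k < 3 ^ n" "dist (c k) p \<le> 2 / 3 ^ n"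
      unfolding p_def by auto
    define k' where "k' = 3 * k + \<alpha> 0"
    have "\<alpha> 0 \<le> 2"
      using \<alpha> by blast
    then have k': "k' div 3 = k" "k' mod 3 = \<alpha> 0" "k' < 3 ^ Suc n"
      using k(1) by (auto simp: k'_def)
    have sw: "(swap12 \<circ> \<alpha>) i \<le> 2" for i
      by (simp add: swap12_def)
    have "ternary_value \<alpha> = (real (\<alpha> 0) + ternary_value \<beta>) / 3"
      "ternary_value (swap12 \<circ> \<alpha>) = (real (swap12 (\<alpha> 0)) + ternary_value (swap12 \<circ> \<beta>)) / 3"
      using ternary_value_rec[of \<alpha>] ternary_value_rec[of "swap12 \<circ> \<alpha>", OF sw] \<alpha>
      by (simp_all add: \<beta>_def[abs_def] o_def)
    \<comment> \<open>Centre and point are images under the same contraction, so the translations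
      cancel.\<close>
    then have "c' k' - (ternary_value \<alpha>, ternary_value (swap12 \<circ> \<alpha>)) = (1/3) *\<^sub>R (c k - p)"
      by (simp add: c'_def k' p_def prod_eq_iff field_simps)
    then have "dist (c' k') (ternary_value \<alpha>, ternary_value (swap12 \<circ> \<alpha>)) = dist (c k) p / 3"
      by (simp add: dist_norm)
    also have "\<dots> \<le> 2 / 3 ^ Suc n"
      using divide_right_mono[OF k(2), of 3] by simp
    finally show ?thesis
      using k'(3) by (intro exI[of _ k']) simp
  qed
  then show ?case
    by blast
qed

text \<open>The sets \<open>U n\<close> need not be measurable, so each is enlarged to the closed
  interval from its infimum to its supremum, whose length is at most the diameter.\<close>

lemma emeasure_lborel_le_suminf_diameter:
  fixes U :: "nat \<Rightarrow> real set"
  assumes A: "A \<in> sets lborel" "A \<subseteq> (\<Union>n. U n)" and bdd: "\<And>n. bounded (U n)"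
  shows "emeasure lborel A \<le> (\<Sum>n. ennreal (diameter (U n)))"
proof -
  define I where "I n = (if U n = {} then {} else {Inf (U n)..Sup (U n)})" for n
  have sub: "U n \<subseteq> I n" for n
    using bounded_imp_bdd_above[OF bdd, of n] bounded_imp_bdd_below[OF bdd, of n]
    by (auto simp: I_def intro: cInf_lower cSup_upper)
  have I_sets: "I n \<in> sets lborel" for n
    by (simp add: I_def)
  have "A \<subseteq> (\<Union>n. I n)"
    using A(2) sub by blast
  then have "emeasure lborel A \<le> emeasure lborel (\<Union>n. I n)"
    using I_sets by (intro emeasure_mono sets.countable_UN) auto
  also have "\<dots> \<le> (\<Sum>n. emeasure lborel (I n))"
    using I_sets by (intro emeasure_subadditive_countably) auto
  also have "emeasure lborel (I n) \<le> ennreal (diameter (U n))" for n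
  proof (cases "U n = {}")
    case False
    have "Sup (U n) \<le> Inf (U n) + diameter (U n)"
    proof (rule cSup_least[OF False])
      fix x assume x: "x \<in> U n"
      have "x - diameter (U n) \<le> Inf (U n)"
      proof (rule cInf_greatest[OF False])
        fix y assume "y \<in> U n"
        with x have "dist x y \<le> diameter (U n)"
          by (intro diameter_bounded_bound bdd)
        then show "x - diameter (U n) \<le> y"
          by (simp add: dist_real_def)
      qed
      then show "x \<le> Inf (U n) + diameter (U n)" by simp
    qed
    moreover have "Inf (U n) \<le> Sup (U n)"
      using False bdd by (intro cInf_le_cSup bounded_imp_bdd_above bounded_imp_bdd_below)
    ultimately show ?thesis
      using False by (simp add: I_def ennreal_leI)
  qed (simp add: I_def)
  then have "(\<Sum>n. emeasure lborel (I n)) \<le> (\<Sum>n. ennreal (diameter (U n)))"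
    by (intro suminf_le) auto
  finally show ?thesis .
qed

lemma diameter_fst_image_le:
  fixes S :: "('a::real_normed_vector \<times> 'b::metric_space) set"
  assumes "bounded S"
  shows "diameter (fst ` S) \<le> diameter S"
proof (cases "S = {}")
  case False
  show ?thesis
  proof (rule diameter_le)
    show "fst ` S \<noteq> {} \<or> 0 \<le> diameter S"
      using False by simp
    fix x y assume "x \<in> fst ` S" "y \<in> fst ` S"
    then obtain p q where "p \<in> S" "q \<in> S" "x = fst p" "y = fst q"
      by blast
    then show "norm (x - y) \<le> diameter S"
      using dist_fst_le[of p q] diameter_bounded_bound[OF assms, of p q]
      by (simp flip: dist_norm)
  qed
qed simp

text \<open>On [0, 1], lowering the exponent from 1 to s does not decrease a power. For s = 0 and S
  nonempty, the value 1 of \<open>diam_pow\<close> dominates the diameter directly.\<close>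

lemma diameter_le_diam_pow:
  assumes "0 \<le> s" "s \<le> 1" "bounded S" "diameter S \<le> 1"
  shows "ennreal (diameter S) \<le> diam_pow s S"
proof -
  have "diameter S \<le> diameter S powr s"
  proof (cases "diameter S = 0")
    case False
    then have "0 < diameter S"
      using diameter_ge_0[OF assms(3)] by simp
    then show ?thesis
      using powr_mono'[of s 1 "diameter S"] assms by simp
  qed simp
  then show ?thesis
    using assms by (auto simp: diam_pow_def ennreal_leI)
qed

text \<open>The Hausdorff measure is a supremum over \<open>\<delta>\<close>, so a bound at the
  single scale 1 is enough; there all diameters are at most 1, as the comparison with
  \<open>diam_pow\<close> requires.\<close>

lemma hausdorff_measure_ge_projection:
  fixes A :: "(real \<times> 'b::metric_space) set"
  assumes s: "0 \<le> s" "s \<le> 1" and meas: "fst ` A \<in> sets lborel"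
  shows "emeasure lborel (fst ` A) \<le> hausdorff_measure s A"
proof -
  have "emeasure lborel (fst ` A) \<le> (\<Sum>n. diam_pow s (U n))" if "U \<in> delta_covers 1 A" for U
  proof -
    have cover: "A \<subseteq> (\<Union>n. U n)" and bdd: "\<And>n. bounded (U n)"
      and diam: "\<And>n. diameter (U n) \<le> 1"
      using that by (auto simp: delta_covers_def)
    have "emeasure lborel (fst ` A) \<le> (\<Sum>n. ennreal (diameter (fst ` U n)))"
      using cover bdd by (intro emeasure_lborel_le_suminf_diameter meas bounded_fst) blast+
    also have "\<dots> \<le> (\<Sum>n. diam_pow s (U n))"
      using diameter_le_diam_pow[OF s bdd diam] diameter_fst_image_le[OF bdd]
      by (intro suminf_le) (blast intro: order_trans ennreal_leI, auto)
    finally show ?thesis .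
  qed
  then have "emeasure lborel (fst ` A) \<le> hausdorff_premeasure s 1 A"
    unfolding hausdorff_premeasure_def by (rule INF_greatest)
  also have "\<dots> \<le> hausdorff_measure s A"
    unfolding hausdorff_measure_def by (rule SUP_upper) simp
  finally show ?thesis .
qed

theorem theorem5:
  shows "hausdorff_dim {(x, swap_fun x) | x. x \<in> {0..1}} = 1"
proof -
  let ?G = "{(x, swap_fun x) | x. x \<in> {0..1::real}}"
  have cover: "\<exists>c. ?G \<subseteq> (\<Union>k<(3::nat) ^ n. cball (c k) (2 / real 3 ^ n))" for n
  proof -
    obtain c :: "nat \<Rightarrow> real \<times> real" where c: "\<And>\<alpha>. \<forall>i. \<alpha> i \<le> 2 \<Longrightarrow>
      \<exists>k<3 ^ n. (ternary_value \<alpha>, ternary_value (swap12 \<circ> \<alpha>)) \<in> cball (c k) (2 / 3 ^ n)"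
      using swap_pair_cover[of n] by blast
    have "\<exists>k<3 ^ n. (x, swap_fun x) \<in> cball (c k) (2 / 3 ^ n)" if x: "x \<in> {0..1}" for x
    proof -
      \<comment> \<open>On the admissible expansion \<open>swap_fun\<close> acts digit by digit, so
        the graph point is one of the covered pairs.\<close>
      obtain \<alpha> where "admissible \<alpha>" "ternary_value \<alpha> = x"
        using admissible_ex[OF x] by blast
      then show ?thesis
        using c[of \<alpha>] swap_fun_ternary_value[of \<alpha>] admissible_le_2[of \<alpha>] by auto
    qed
    then show ?thesis
      using exI[of "\<lambda>c. ?G \<subseteq> (\<Union>k<(3::nat) ^ n. cball (c k) (2 / real 3 ^ n))" c] by fastforce
  qed
  have zero: "hausdorff_measure s ?G = 0" if "1 < s" for s
    by (rule hausdorff_measure_eq_0_if_power_cballs[where b = 3 and K = 2, OF cover _ _ that]) auto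
  have proj: "fst ` ?G = {0..1}"
    by force
  have ge_1: "1 \<le> hausdorff_measure s ?G" if "0 \<le> s" "s \<le> 1" for s
    using hausdorff_measure_ge_projection[OF that, of ?G] unfolding proj by simp
  have "1 < s" if "0 \<le> s" "hausdorff_measure s ?G = 0" for s
  proof (rule ccontr)
    assume "\<not> 1 < s"
    then show False
      using ge_1[of s] that by simp
  qed
  then have "1 \<le> hausdorff_dim ?G"
    unfolding hausdorff_dim_def by (intro INF_greatest) (auto simp: less_imp_le)
  moreover have "hausdorff_dim ?G \<le> 1"
  \<comment> \<open>By \<open>ge_1\<close> the exponent 1 does not give measure 0, so the infimum is
    approached through the exponents 1 + e.\<close>
  proof (rule ennreal_le_epsilon)
    fix e :: real assume "0 < e"
    then have "hausdorff_dim ?G \<le> ennreal (1 + e)"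
      unfolding hausdorff_dim_def using zero[of "1 + e"]
      by (intro INF_lower) simp
    then show "hausdorff_dim ?G \<le> 1 + ennreal e"
      using \<open>0 < e\<close> by (simp add: ennreal_plus)
  qed
  ultimately show ?thesis
    by (rule antisym[rotated])
qed

end
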